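(* Let $G$ be a finite group and $\mathcal S$ a set of 3-element subsets of $G$ such that the associated hypergraph $H$ is a commutative triplet structure (conditions (0), (A), (B), (C), (D), (E) below hold). Then $$\lambda(G_{walk})\le \sqrt{\tfrac12+\tfrac12\,\lambda\big(G_{cay}\,ⓩ\,L\big)}.$$
   Context: Types: $\mathcal T$ is the set of 2-element subsets $\{a,b\}\subset G$ contained in some member of $\mathcal S$; $\mathcal T_o$ is the set of ordered pairs $(a,b)$ with $\{a,b\}\in\mathcal T$, and for $t=(a,b)$ put $t^{-1}=(b^{-1},a^{-1})$. The hypergraph $H$ has vertex set $G$ and triples $\{sg,s'g,s''g\}$ for $g\in G$, $\{s,s',s''\}\in\mathcal S$; its skeleton $E^1$ is the set of 2-element subsets of triples, i.e. the sets $e(g,\tau):=\{ag,bg\}$ for $g\in G$, $\tau=\{a,b\}\in\mathcal T$. $L$ is the graph on $\mathcal T$ with $\tau\sim\tau'$ iff $\tau\ne\tau'$ and some member of $\mathcal S$ contains $\tau\cup\tau'$. Conditions: (0) no $\tau\in\mathcal T$ has the form $\{s,s^{-1}\}$; (A) if $t\in\mathcal T_o$ then $t^{-1}\in\mathcal T_o$; (B) for $t\neq t'$ in $\mathcal T_o$, $t_1t_2^{-1}=t'_1(t'_2)^{-1}$ implies $t'_2=t_1^{-1}$ and $t'_1=t_2^{-1}$; (C) every $\tau\in\mathcal T$ is contained in exactly $\tilde d$ members of $\mathcal S$ (for a fixed $\tilde d$); (D) $L$ is connected; (E) for every $\{a,b\}\in\mathcal T$, $ab=ba$. For $\tau=\{a,b\}\in\mathcal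 T$ write $\tau g:=abg$ and $\tau^{-1}:=\{a^{-1},b^{-1}\}$. $G_{walk}$ is the graph with vertex set $E^1$, where $\mathcal E\sim\mathcal E'$ iff $\mathcal E\neq\mathcal E'$ and some triple of $H$ contains $\mathcal E\cup\mathcal E'$. $G_{cay}$ is the Cayley graph on $G$ with edges $\{g,\tau g\}$ for $g\in G,\tau\in\mathcal T$. The zig-zag product $G_{cay}ⓩL$ is defined on vertex set $G\times\mathcal T$: let $P_R$ be the normalized adjacency operator of the "red" edges $(g,\tau)\sim(g,\tau')$ for $\tau\sim\tau'$ in $L$ (so $P_R$ is a copy of the normalized adjacency of $L$ on each $\{g\}\times\mathcal T$), and $P_B$ the permutation matrix of the "blue" perfect matching $(g,\tau)\leftrightarrow(\tau g,\tau^{-1})$; $G_{cay}ⓩL$ is the (regular multi)graph with normalized adjacency $P_RP_BP_R$. For a regular graph, $\lambda(\cdot)$ denotes the largest absolute value of an eigenvalue of its normalized adjacency matrix (adjacency divided by degree) other than the top eigenvalue $1$. *)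

theory Defs
  imports Complex_Main "HOL-Algebra.Group" "HOL-Library.Function_Algebras"
begin

section \<open>Spectra of graphs on a finite vertex set\<close>

text \<open>
  Matrices indexed by a vertex set \<open>V\<close> are functions \<open>'v \<Rightarrow> 'v \<Rightarrow> real\<close> of which only the entries
  in \<open>V \<times> V\<close> matter; vectors are functions vanishing outside \<open>V\<close>.
\<close>

definition norm_adj :: "'v set \<Rightarrow> ('v \<Rightarrow> 'v \<Rightarrow> bool) \<Rightarrow> 'v \<Rightarrow> 'v \<Rightarrow> real" where
  "norm_adj V adj v w = of_bool (adj v w) / real (card {u \<in> V. adj v u})"

definition mat_prod :: "'v set \<Rightarrow> ('v \<Rightarrow> 'v \<Rightarrow> real) \<Rightarrow> ('v \<Rightarrow> 'v \<Rightarrow> real) \<Rightarrow> 'v \<Rightarrow> 'v \<Rightarrow> real" where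
  "mat_prod V M N v w = (\<Sum>u\<in>V. M v u * N u w)"

definition eigenspace :: "'v set \<Rightarrow> ('v \<Rightarrow> 'v \<Rightarrow> real) \<Rightarrow> real \<Rightarrow> ('v \<Rightarrow> real) set" where
  "eigenspace V M \<mu> =
     {f. (\<forall>v. v \<notin> V \<longrightarrow> f v = 0) \<and> (\<forall>v\<in>V. (\<Sum>w\<in>V. M v w * f w) = \<mu> * f v)}"

definition eigenvalue_mult :: "'v set \<Rightarrow> ('v \<Rightarrow> 'v \<Rightarrow> real) \<Rightarrow> real \<Rightarrow> nat" where
  "eigenvalue_mult V M \<mu> = vector_space.dim (\<lambda>(c::real) f v. c * f v) (eigenspace V M \<mu>)"

text \<open>
  Eigenvalues are counted with multiplicity and a single copy of the top eigenvalue \<open>1\<close> is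
  discarded, so \<open>1\<close> still contributes when its eigenspace has dimension at least two (that is,
  for a disconnected graph). The value is \<open>0\<close> if no eigenvalue is left, which happens only
  when there is at most one vertex.
\<close>

definition spectral_lambda :: "'v set \<Rightarrow> ('v \<Rightarrow> 'v \<Rightarrow> real) \<Rightarrow> real" where
  "spectral_lambda V M =
     Max (insert 0 {\<bar>\<mu>\<bar> | \<mu>. eigenvalue_mult V M \<mu> > (if \<mu> = 1 then 1 else 0)})"


section \<open>Triplet structures\<close>

definition pair_types :: "'a set set \<Rightarrow> 'a set set" where
  "pair_types S = {\<tau>. card \<tau> = 2 \<and> (\<exists>\<sigma>\<in>S. \<tau> \<subseteq> \<sigma>)}"

definition ordered_types :: "'a set set \<Rightarrow> ('a \<times> 'a) set" where
  "ordered_types S = {(a, b). {a, b} \<in> pair_types S}"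

definition link_adj :: "'a set set \<Rightarrow> 'a set \<Rightarrow> 'a set \<Rightarrow> bool" where
  "link_adj S \<tau> \<tau>' \<longleftrightarrow> \<tau> \<in> pair_types S \<and> \<tau>' \<in> pair_types S \<and> \<tau> \<noteq> \<tau>' \<and> (\<exists>\<sigma>\<in>S. \<tau> \<union> \<tau>' \<subseteq> \<sigma>)"

definition cond_0 :: "('a, 'b) monoid_scheme \<Rightarrow> 'a set set \<Rightarrow> bool" where
  "cond_0 G S \<longleftrightarrow> (\<forall>\<tau>\<in>pair_types S. \<not> (\<exists>s\<in>carrier G. \<tau> = {s, inv\<^bsub>G\<^esub> s}))"

definition cond_A :: "('a, 'b) monoid_scheme \<Rightarrow> 'a set set \<Rightarrow> bool" where
  "cond_A G S \<longleftrightarrow>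
     (\<forall>a b. (a, b) \<in> ordered_types S \<longrightarrow> (inv\<^bsub>G\<^esub> b, inv\<^bsub>G\<^esub> a) \<in> ordered_types S)"

definition cond_B :: "('a, 'b) monoid_scheme \<Rightarrow> 'a set set \<Rightarrow> bool" where
  "cond_B G S \<longleftrightarrow>
     (\<forall>t\<in>ordered_types S. \<forall>t'\<in>ordered_types S. t \<noteq> t' \<longrightarrow>
        fst t \<otimes>\<^bsub>G\<^esub> inv\<^bsub>G\<^esub> (snd t) = fst t' \<otimes>\<^bsub>G\<^esub> inv\<^bsub>G\<^esub> (snd t') \<longrightarrow>
        snd t' = inv\<^bsub>G\<^esub> (fst t) \<and> fst t' = inv\<^bsub>G\<^esub> (snd t))"

definition cond_C :: "'a set set \<Rightarrow> bool" where
  "cond_C S \<longleftrightarrow> (\<exists>d::nat. \<forall>\<tau>\<in>pair_types S. card {\<sigma> \<in> S. \<tau> \<subseteq> \<sigma>} = d)"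

definition cond_D :: "'a set set \<Rightarrow> bool" where
  "cond_D S \<longleftrightarrow> (\<forall>\<tau>\<in>pair_types S. \<forall>\<tau>'\<in>pair_types S. (link_adj S)\<^sup>*\<^sup>* \<tau> \<tau>')"

definition cond_E :: "('a, 'b) monoid_scheme \<Rightarrow> 'a set set \<Rightarrow> bool" where
  "cond_E G S \<longleftrightarrow> (\<forall>a b. {a, b} \<in> pair_types S \<longrightarrow> a \<otimes>\<^bsub>G\<^esub> b = b \<otimes>\<^bsub>G\<^esub> a)"

definition commutative_triplet_structure :: "('a, 'b) monoid_scheme \<Rightarrow> 'a set set \<Rightarrow> bool" where
  "commutative_triplet_structure G S \<longleftrightarrow>
     cond_0 G S \<and> cond_A G S \<and> cond_B G S \<and> cond_C S \<and> cond_D S \<and> cond_E G S"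


section \<open>The walk on the skeleton\<close>

definition triples :: "('a, 'b) monoid_scheme \<Rightarrow> 'a set set \<Rightarrow> 'a set set" where
  "triples G S = {(\<lambda>s. s \<otimes>\<^bsub>G\<^esub> g) ` \<sigma> | g \<sigma>. g \<in> carrier G \<and> \<sigma> \<in> S}"

definition skeleton :: "('a, 'b) monoid_scheme \<Rightarrow> 'a set set \<Rightarrow> 'a set set" where
  "skeleton G S = {e. card e = 2 \<and> (\<exists>h\<in>triples G S. e \<subseteq> h)}"

definition walk_adj :: "('a, 'b) monoid_scheme \<Rightarrow> 'a set set \<Rightarrow> 'a set \<Rightarrow> 'a set \<Rightarrow> bool" where
  "walk_adj G S e e' \<longleftrightarrow>
     e \<in> skeleton G S \<and> e' \<in> skeleton G S \<and> e \<noteq> e' \<and> (\<exists>h\<in>triples G S. e \<union> e' \<subseteq> h)"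

definition lambda_walk :: "('a, 'b) monoid_scheme \<Rightarrow> 'a set set \<Rightarrow> real" where
  "lambda_walk G S = spectral_lambda (skeleton G S) (norm_adj (skeleton G S) (walk_adj G S))"


section \<open>The zig-zag product\<close>

text \<open>The product \<open>ab\<close> of the elements of a type \<open>{a, b}\<close>, unambiguous when \<open>ab = ba\<close>.\<close>

definition type_prod :: "('a, 'b) monoid_scheme \<Rightarrow> 'a set \<Rightarrow> 'a" where
  "type_prod G \<tau> = (THE p. \<exists>a b. a \<noteq> b \<and> \<tau> = {a, b} \<and> p = a \<otimes>\<^bsub>G\<^esub> b)"

definition zigzag_verts :: "('a, 'b) monoid_scheme \<Rightarrow> 'a set set \<Rightarrow> ('a \<times> 'a set) set" where
  "zigzag_verts G S = carrier G \<times> pair_types S"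

definition red_adj :: "'a set set \<Rightarrow> 'a \<times> 'a set \<Rightarrow> 'a \<times> 'a set \<Rightarrow> bool" where
  "red_adj S x y \<longleftrightarrow> fst x = fst y \<and> link_adj S (snd x) (snd y)"

definition blue_map :: "('a, 'b) monoid_scheme \<Rightarrow> 'a \<times> 'a set \<Rightarrow> 'a \<times> 'a set" where
  "blue_map G x = (type_prod G (snd x) \<otimes>\<^bsub>G\<^esub> fst x, (\<lambda>s. inv\<^bsub>G\<^esub> s) ` snd x)"

definition P_red ::
  "('a, 'b) monoid_scheme \<Rightarrow> 'a set set \<Rightarrow> 'a \<times> 'a set \<Rightarrow> 'a \<times> 'a set \<Rightarrow> real" where
  "P_red G S = norm_adj (zigzag_verts G S) (red_adj S)"

definition P_blue :: "('a, 'b) monoid_scheme \<Rightarrow> 'a \<times> 'a set \<Rightarrow> 'a \<times> 'a set \<Rightarrow> real" where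
  "P_blue G x y = of_bool (y = blue_map G x)"

definition zigzag_matrix ::
  "('a, 'b) monoid_scheme \<Rightarrow> 'a set set \<Rightarrow> 'a \<times> 'a set \<Rightarrow> 'a \<times> 'a set \<Rightarrow> real" where
  "zigzag_matrix G S =
     mat_prod (zigzag_verts G S) (P_red G S)
       (mat_prod (zigzag_verts G S) (P_blue G) (P_red G S))"

definition lambda_zigzag :: "('a, 'b) monoid_scheme \<Rightarrow> 'a set set \<Rightarrow> real" where
  "lambda_zigzag G S = spectral_lambda (zigzag_verts G S) (zigzag_matrix G S)"

end

theory Submission
  imports Defs "HOL-Analysis.Function_Topology"
begin

text \<open>
  The map \<open>(g, {a, b}) \<mapsto> {a g, b g}\<close> from \<open>G \<times> \<T>\<close> onto the skeleton is two-to-one, its fibres being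
  exactly the blue pairs. Hence an eigenvector \<open>f\<close> of the walk with eigenvalue \<open>\<mu>\<close> and entry sum
  \<open>0\<close> pulls back to a vector \<open>F\<close> with entry sum \<open>0\<close> such that
  \<open>\<mu> F = (I + P\<^sub>B) / 2 \<cdot> P\<^sub>R F\<close>. As \<open>(I + P\<^sub>B) / 2\<close> is an orthogonal projection,
  \<open>\<mu>\<^sup>2 |F|\<^sup>2 = |P\<^sub>R F|\<^sup>2 / 2 + \<langle>F, P\<^sub>R P\<^sub>B P\<^sub>R F\<rangle> / 2\<close>, where \<open>P\<^sub>R\<close> is a contraction and the last inner
  product is at most \<open>\<lambda> |F|\<^sup>2\<close> for the zig-zag product.
\<close>

section \<open>Symmetric stochastic matrices and the Rayleigh quotient\<close>

definition mat_vec :: "'v set \<Rightarrow> ('v \<Rightarrow> 'v \<Rightarrow> real) \<Rightarrow> ('v \<Rightarrow> real) \<Rightarrow> 'v \<Rightarrow> real" where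
  "mat_vec V M f v = (\<Sum>w\<in>V. M v w * f w)"

definition symmetric_on :: "'v set \<Rightarrow> ('v \<Rightarrow> 'v \<Rightarrow> real) \<Rightarrow> bool" where
  "symmetric_on V M \<longleftrightarrow> (\<forall>v\<in>V. \<forall>w\<in>V. M v w = M w v)"

lemma mem_eigenspace_iff:
  "f \<in> eigenspace V M \<mu> \<longleftrightarrow> (\<forall>v. v \<notin> V \<longrightarrow> f v = 0) \<and> (\<forall>v\<in>V. mat_vec V M f v = \<mu> * f v)"
  by (simp add: eigenspace_def mat_vec_def)

lemma mat_vec_add: "mat_vec V M (\<lambda>v. f v + c * g v) v = mat_vec V M f v + c * mat_vec V M g v"
  by (simp add: mat_vec_def algebra_simps sum.distrib sum_distrib_left)

lemma mat_vec_cong: "(\<And>v. v \<in> V \<Longrightarrow> f v = g v) \<Longrightarrow> mat_vec V M f v = mat_vec V M g v"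
  by (simp add: mat_vec_def)

lemma mat_vec_symmetric:
  assumes "symmetric_on V M"
  shows "(\<Sum>v\<in>V. f v * mat_vec V M g v) = (\<Sum>v\<in>V. mat_vec V M f v * g v)"
proof -
  have "(\<Sum>v\<in>V. f v * mat_vec V M g v) = (\<Sum>v\<in>V. \<Sum>w\<in>V. f v * M v w * g w)"
    by (simp add: mat_vec_def sum_distrib_left mult.assoc)
  also have "\<dots> = (\<Sum>w\<in>V. \<Sum>v\<in>V. f v * M v w * g w)"
    by (rule sum.swap)
  also have "\<dots> = (\<Sum>w\<in>V. mat_vec V M f w * g w)"
    using assms by (auto simp: mat_vec_def symmetric_on_def sum_distrib_right intro!: sum.cong)
  finally show ?thesis .
qed

lemma sum_mat_vec:
  assumes "symmetric_on V M" and "\<And>v. v \<in> V \<Longrightarrow> (\<Sum>w\<in>V. M v w) = 1"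
  shows "(\<Sum>v\<in>V. mat_vec V M f v) = (\<Sum>v\<in>V. f v)"
proof -
  have "(\<Sum>v\<in>V. f v) = (\<Sum>v\<in>V. f v * mat_vec V M (\<lambda>_. 1) v)"
    using assms(2) by (simp add: mat_vec_def)
  then show ?thesis
    by (simp add: mat_vec_symmetric[OF assms(1)])
qed

text \<open>Each row is a probability distribution, so the square of an average is at most the
  average of the squares. By symmetry the columns also sum to \<open>1\<close>, so adding up the
  rows restores the plain sum of squares.\<close>

lemma mat_vec_contraction:
  assumes sym: "symmetric_on V M" and rows: "\<And>v. v \<in> V \<Longrightarrow> (\<Sum>w\<in>V. M v w) = 1"
    and nonneg: "\<And>v w. 0 \<le> M v w"
  shows "(\<Sum>v\<in>V. (mat_vec V M f v)\<^sup>2) \<le> (\<Sum>v\<in>V. (f v)\<^sup>2)"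
proof -
  have "(mat_vec V M f v)\<^sup>2 \<le> mat_vec V M (\<lambda>w. (f w)\<^sup>2) v" if "v \<in> V" for v
  proof -
    let ?m = "mat_vec V M f v"
    \<comment> \<open>This is the variance of \<open>f\<close> under row \<open>v\<close>, whose
      mean is \<open>?m\<close>.\<close>
    have "0 \<le> (\<Sum>w\<in>V. M v w * (f w - ?m)\<^sup>2)"
      by (intro sum_nonneg mult_nonneg_nonneg nonneg) auto
    also have "\<dots> = (\<Sum>w\<in>V. M v w * (f w)\<^sup>2) - 2 * ?m * (\<Sum>w\<in>V. M v w * f w)
        + ?m\<^sup>2 * (\<Sum>w\<in>V. M v w)"
      by (simp add: power2_diff algebra_simps sum.distrib sum_subtractf sum_distrib_left
          sum_distrib_right)
    also have "\<dots> = mat_vec V M (\<lambda>w. (f w)\<^sup>2) v - ?m\<^sup>2"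
      using rows[OF that] by (simp add: mat_vec_def power2_eq_square)
    finally show ?thesis by simp
  qed
  then have "(\<Sum>v\<in>V. (mat_vec V M f v)\<^sup>2) \<le> (\<Sum>v\<in>V. mat_vec V M (\<lambda>w. (f w)\<^sup>2) v)"
    by (rule sum_mono)
  with sum_mat_vec[OF sym rows] show ?thesis by simp
qed

section \<open>Eigenspaces, their dimensions and sum-zero eigenvectors\<close>

text \<open>The scaling is spelled as in \<open>eigenvalue_mult\<close>, so
  \<open>real_fun.dim\<close> is the dimension used there.\<close>

interpretation real_fun: vector_space "\<lambda>(c::real) (f::'v \<Rightarrow> real) v. c * f v"
  by unfold_locales (auto simp: fun_eq_iff algebra_simps)

lemma sum_fun_apply: "(\<Sum>i\<in>I. F i) x = (\<Sum>i\<in>I. F i x :: real)"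
  by (induction I rule: infinite_finite_induct) auto

text \<open>Supplies the finite spanning set that makes independent families of vectors on
  \<open>V\<close> finite.\<close>

lemma supported_in_span_indicators:
  fixes f :: "'v \<Rightarrow> real"
  assumes "finite V" and "\<And>v. v \<notin> V \<Longrightarrow> f v = 0"
  shows "f \<in> real_fun.span ((\<lambda>v w. of_bool (v = w)) ` V)"
proof -
  have "f = (\<Sum>v\<in>V. (\<lambda>w. f v * of_bool (v = w)))"
  proof
    fix x
    have "(\<Sum>v\<in>V. f v * of_bool (v = x)) = f x"
      using assms by (cases "x \<in> V") (auto simp: sum.delta if_distrib of_bool_def cong: if_cong)
    then show "f x = (\<Sum>v\<in>V. (\<lambda>w. f v * of_bool (v = w))) x" by (simp add: sum_fun_apply)
  qed
  also have "\<dots> \<in> real_fun.span ((\<lambda>v w. of_bool (v = w)) ` V)"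
    by (intro real_fun.span_sum real_fun.span_scale real_fun.span_base) auto
  finally show ?thesis .
qed

lemma finite_orthogonal_family:
  fixes F :: "'i \<Rightarrow> 'v \<Rightarrow> real"
  assumes "finite V" and supp: "\<And>i v. i \<in> I \<Longrightarrow> v \<notin> V \<Longrightarrow> F i v = 0"
    and nz: "\<And>i. i \<in> I \<Longrightarrow> F i \<noteq> 0"
    and orth: "\<And>i j. i \<in> I \<Longrightarrow> j \<in> I \<Longrightarrow> i \<noteq> j \<Longrightarrow> (\<Sum>v\<in>V. F i v * F j v) = 0"
  shows "finite I"
proof -
  have pos: "(\<Sum>v\<in>V. F i v * F i v) \<noteq> 0" if "i \<in> I" for i
  proof
    assume "(\<Sum>v\<in>V. F i v * F i v) = 0"
    then have "\<forall>v\<in>V. F i v = 0"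
      using \<open>finite V\<close> by (subst (asm) sum_nonneg_eq_0_iff) auto
    with supp nz that show False by (metis ext zero_fun_apply)
  qed
  have inj: "inj_on F I"
  proof (rule inj_onI, rule ccontr)
    fix i j assume ij: "i \<in> I" "j \<in> I" "F i = F j" "i \<noteq> j"
    then show False using pos[of i] orth[of i j] by simp
  qed
  have "real_fun.independent (F ` I)"
    unfolding real_fun.independent_explicit_module
  proof (intro allI impI)
    fix T u g
    assume T: "finite T" "T \<subseteq> F ` I" "(\<Sum>h\<in>T. (\<lambda>v. u h * h v)) = 0" "g \<in> T"
    then obtain i where i: "i \<in> I" "g = F i" by auto
    \<comment> \<open>Pairing the vanishing combination with \<open>g\<close> kills every
      coefficient but that of \<open>g\<close>.\<close>
    have "0 = (\<Sum>v\<in>V. (\<Sum>h\<in>T. (\<lambda>v. u h * h v)) v * g v)"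
      using T(3) by simp
    also have "\<dots> = (\<Sum>v\<in>V. \<Sum>h\<in>T. u h * (h v * g v))"
      by (simp add: sum_fun_apply sum_distrib_right mult.assoc)
    also have "\<dots> = (\<Sum>h\<in>T. u h * (\<Sum>v\<in>V. h v * g v))"
      by (subst sum.swap) (simp add: sum_distrib_left)
    also have "\<dots> = (\<Sum>h\<in>T. if h = g then u g * (\<Sum>v\<in>V. g v * g v) else 0)"
    proof (rule sum.cong)
      fix h assume "h \<in> T"
      then obtain j where "j \<in> I" "h = F j" using T(2) by auto
      then show "u h * (\<Sum>v\<in>V. h v * g v) = (if h = g then u g * (\<Sum>v\<in>V. g v * g v) else 0)"
        using orth[of j i] i by (cases "j = i") auto
    qed simp
    also have "\<dots> = u g * (\<Sum>v\<in>V. g v * g v)"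
      using T by simp
    finally show "u g = 0" using pos i by simp
  qed
  moreover have "F ` I \<subseteq> real_fun.span ((\<lambda>v w. of_bool (v = w)) ` V)"
    using supported_in_span_indicators[OF \<open>finite V\<close>] supp by blast
  ultimately have "finite (F ` I)"
    using real_fun.independent_span_bound[of "(\<lambda>v w. of_bool (v = w)) ` V"] \<open>finite V\<close> by blast
  then show ?thesis using inj by (simp add: finite_image_iff)
qed

lemma eigenvalue_mult_pos_obtains:
  assumes "eigenvalue_mult V M \<mu> > 0"
  obtains f where "f \<in> eigenspace V M \<mu>" and "f \<noteq> 0"
proof -
  have "\<not> eigenspace V M \<mu> \<subseteq> real_fun.span {}"
    using assms real_fun.dim_le_card[of "eigenspace V M \<mu>" "{}"] by (auto simp: eigenvalue_mult_def)
  with that show ?thesis by (auto simp: real_fun.span_empty)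
qed

lemma eigenspaces_orthogonal:
  assumes "symmetric_on V M" and "f \<in> eigenspace V M \<mu>" and "g \<in> eigenspace V M \<nu>" and "\<mu> \<noteq> \<nu>"
  shows "(\<Sum>v\<in>V. f v * g v) = 0"
proof -
  have "\<nu> * (\<Sum>v\<in>V. f v * g v) = (\<Sum>v\<in>V. f v * mat_vec V M g v)"
    using assms(3) by (auto simp: mem_eigenspace_iff sum_distrib_left intro!: sum.cong)
  also have "\<dots> = (\<Sum>v\<in>V. mat_vec V M f v * g v)"
    by (rule mat_vec_symmetric[OF assms(1)])
  also have "\<dots> = \<mu> * (\<Sum>v\<in>V. f v * g v)"
    using assms(2) by (auto simp: mem_eigenspace_iff sum_distrib_left intro!: sum.cong)
  finally show ?thesis using assms(4) by simp
qed

text \<open>One eigenvector chosen per eigenvalue gives an orthogonal family. The finiteness is what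
  makes the \<open>Max\<close> in \<open>spectral_lambda\<close> meaningful.\<close>

lemma finite_eigenvalues:
  assumes "finite V" and "symmetric_on V M"
  shows "finite {\<mu>. eigenvalue_mult V M \<mu> > 0}"
proof -
  obtain F where F: "\<And>\<mu>. eigenvalue_mult V M \<mu> > 0 \<Longrightarrow> F \<mu> \<in> eigenspace V M \<mu> \<and> F \<mu> \<noteq> 0"
    using eigenvalue_mult_pos_obtains by metis
  show ?thesis
  proof (rule finite_orthogonal_family[where F = F, OF assms(1)])
    show "(\<Sum>v\<in>V. F \<mu> v * F \<nu> v) = 0"
      if "\<mu> \<in> {\<mu>. eigenvalue_mult V M \<mu> > 0}" "\<nu> \<in> {\<mu>. eigenvalue_mult V M \<mu> > 0}" "\<mu> \<noteq> \<nu>" for \<mu> \<nu>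
      using eigenspaces_orthogonal[OF assms(2)] F that by blast
  qed (use F in \<open>auto simp: mem_eigenspace_iff\<close>)
qed

lemma finite_spectral_lambda_set:
  assumes "finite V" and "symmetric_on V M"
  shows "finite {\<bar>\<mu>\<bar> | \<mu>. eigenvalue_mult V M \<mu> > (if \<mu> = 1 then 1 else 0)}"
proof (rule finite_subset)
  show "{\<bar>\<mu>\<bar> | \<mu>. eigenvalue_mult V M \<mu> > (if \<mu> = 1 then 1 else 0)}
      \<subseteq> abs ` {\<mu>. eigenvalue_mult V M \<mu> > 0}"
    by (fastforce split: if_splits)
qed (simp add: finite_eigenvalues assms)

lemma spectral_lambda_nonneg:
  assumes "finite V" and "symmetric_on V M"
  shows "0 \<le> spectral_lambda V M"
  unfolding spectral_lambda_def using finite_spectral_lambda_set[OF assms] by (intro Max_ge) auto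

lemma ones_in_eigenspace:
  assumes "\<And>v. v \<in> V \<Longrightarrow> (\<Sum>w\<in>V. M v w) = 1"
  shows "(\<lambda>v. of_bool (v \<in> V)) \<in> eigenspace V M 1"
proof -
  have "mat_vec V M (\<lambda>v. of_bool (v \<in> V)) v = (\<Sum>w\<in>V. M v w)" for v
    by (simp add: mat_vec_def)
  with assms show ?thesis by (simp add: mem_eigenspace_iff)
qed

text \<open>Discarding one copy of \<open>1\<close> amounts to restricting to entry sum
  \<open>0\<close>: eigenvectors for \<open>\<mu> \<noteq> 1\<close> are orthogonal to the
  constants, and a second dimension for \<open>\<mu> = 1\<close> yields a sum-zero eigenvector after
  subtracting the mean.\<close>

lemma spectral_lambda_leI:
  assumes V: "finite V" and sym: "symmetric_on V M"
    and rows: "\<And>v. v \<in> V \<Longrightarrow> (\<Sum>w\<in>V. M v w) = 1" and "0 \<le> b"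
    and bound: "\<And>\<mu> f. f \<in> eigenspace V M \<mu> \<Longrightarrow> f \<noteq> 0 \<Longrightarrow> (\<Sum>v\<in>V. f v) = 0 \<Longrightarrow> \<bar>\<mu>\<bar> \<le> b"
  shows "spectral_lambda V M \<le> b"
proof -
  let ?ones = "\<lambda>v. of_bool (v \<in> V) :: real"
  have "\<bar>\<mu>\<bar> \<le> b" if mult: "eigenvalue_mult V M \<mu> > (if \<mu> = 1 then 1 else 0)" for \<mu>
  proof (cases "\<mu> = 1")
    case False
    with mult obtain f where f: "f \<in> eigenspace V M \<mu>" "f \<noteq> 0"
      using eigenvalue_mult_pos_obtains by (metis (full_types))
    have "(\<Sum>v\<in>V. f v) = (\<Sum>v\<in>V. f v * ?ones v)"
      by simp
    also have "\<dots> = 0"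
      using eigenspaces_orthogonal[OF sym f(1) ones_in_eigenspace] rows False by blast
    finally show ?thesis using bound f by blast
  next
    case True
    have "\<not> eigenspace V M 1 \<subseteq> real_fun.span {?ones}"
    proof
      assume "eigenspace V M 1 \<subseteq> real_fun.span {?ones}"
      then have "eigenvalue_mult V M 1 \<le> card {?ones}"
        unfolding eigenvalue_mult_def by (rule real_fun.dim_le_card) simp
      with mult True show False by simp
    qed
    then obtain f where f: "f \<in> eigenspace V M 1" "f \<notin> real_fun.span {?ones}" by blast
    \<comment> \<open>Here \<open>c\<close> is the mean of \<open>f\<close>. Subtracting it stays
      inside the eigenspace of \<open>1\<close>, which contains the constants.\<close>
    define c where "c = (\<Sum>v\<in>V. f v) / card V"
    define g where "g = (\<lambda>v. f v + (- c) * ?ones v)"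
    have "g \<in> eigenspace V M 1"
      using f(1) ones_in_eigenspace[of V M, OF rows]
      unfolding mem_eigenspace_iff g_def mat_vec_add by simp
    moreover have "g \<noteq> 0"
    proof
      assume "g = 0"
      then have "f = (\<lambda>v. c * ?ones v)"
        by (auto simp: g_def fun_eq_iff)
      with f(2) show False by (auto simp: real_fun.span_singleton)
    qed
    moreover have "(\<Sum>v\<in>V. g v) = 0"
      using V by (cases "V = {}") (simp_all add: g_def c_def sum_subtractf)
    ultimately show ?thesis using bound True by blast
  qed
  then have "\<forall>x\<in>insert 0 {\<bar>\<mu>\<bar> | \<mu>. eigenvalue_mult V M \<mu> > (if \<mu> = 1 then 1 else 0)}. x \<le> b"
    using \<open>0 \<le> b\<close> by blast
  then show ?thesis
    unfolding spectral_lambda_def using finite_spectral_lambda_set[OF V sym]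
    by (subst Max_le_iff) simp_all
qed

text \<open>The converse direction. Only \<open>\<mu> = 1\<close> needs care: a nonzero sum-zero
  eigenvector and the constants together force multiplicity at least two.\<close>

lemma eigenvalue_le_spectral_lambda:
  assumes V: "finite V" and sym: "symmetric_on V M"
    and rows: "\<And>v. v \<in> V \<Longrightarrow> (\<Sum>w\<in>V. M v w) = 1"
    and f: "f \<in> eigenspace V M \<mu>" "f \<noteq> 0" "(\<Sum>v\<in>V. f v) = 0"
  shows "\<bar>\<mu>\<bar> \<le> spectral_lambda V M"
proof -
  let ?E = "eigenspace V M \<mu>"
  let ?ones = "\<lambda>v. of_bool (v \<in> V) :: real"
  obtain B where B: "B \<subseteq> ?E" "real_fun.independent B" "?E \<subseteq> real_fun.span B"
    "card B = real_fun.dim ?E"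
    using real_fun.basis_exists by blast
  \<comment> \<open>Finiteness of \<open>B\<close> has to be secured first, since
    \<open>card\<close> of an infinite basis would be \<open>0\<close>.\<close>
  have "B \<subseteq> real_fun.span ((\<lambda>v w. of_bool (v = w)) ` V)"
    using B(1) supported_in_span_indicators[OF V] by (auto simp: mem_eigenspace_iff)
  then have finB: "finite B"
    using real_fun.independent_span_bound[of "(\<lambda>v w. of_bool (v = w)) ` V" B] B(2) V by blast
  obtain v0 where v0: "v0 \<in> V" "f v0 \<noteq> 0"
    using f by (auto simp: mem_eigenspace_iff fun_eq_iff)
  have "B \<noteq> {}"
    using B(3) f by auto
  then have "card B > 0" using finB by (simp add: card_gt_0_iff)
  moreover have "card B > 1" if "\<mu> = 1"
  proof (rule ccontr)
    assume "\<not> card B > 1"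
    with \<open>card B > 0\<close> have "card B = 1" by simp
    then obtain h where h: "B = {h}" by (auto simp: card_1_singleton_iff)
    have "?ones \<in> ?E" using ones_in_eigenspace[OF rows] that by simp
    \<comment> \<open>On a one-dimensional eigenspace \<open>f\<close> would be proportional to the
      constants, and a constant with sum \<open>0\<close> vanishes, against the choice of
      \<open>v0\<close>.\<close>
    with B(3) f(1) h obtain k l where k: "f = (\<lambda>v. k * h v)" and l: "?ones = (\<lambda>v. l * h v)"
      unfolding h real_fun.span_singleton by blast
    have "l \<noteq> 0" using fun_cong[OF l, of v0] v0 by auto
    have fl: "f v = k / l" if "v \<in> V" for v
      using fun_cong[OF l, of v] fun_cong[OF k, of v] \<open>l \<noteq> 0\<close> that by (simp add: field_simps)
    then have "(\<Sum>v\<in>V. f v) = card V * f v0"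
      using v0 by simp
    with f(3) v0 V show False by auto
  qed
  ultimately have "eigenvalue_mult V M \<mu> > (if \<mu> = 1 then 1 else 0)"
    using B(4) by (simp add: eigenvalue_mult_def)
  then have "\<bar>\<mu>\<bar> \<in> insert 0 {\<bar>\<mu>\<bar> | \<mu>. eigenvalue_mult V M \<mu> > (if \<mu> = 1 then 1 else 0)}"
    by blast
  then show ?thesis
    unfolding spectral_lambda_def using finite_spectral_lambda_set[OF V sym]
    by (intro Max_ge) simp_all
qed

section \<open>The Rayleigh quotient on sum-zero vectors\<close>

text \<open>Vectors live on the whole type, so compactness is taken in the product topology: the set
  is closed in a box with factor \<open>{-1..1}\<close> on \<open>V\<close> and \<open>{0}\<close>
  elsewhere, compact by Tychonoff's theorem.\<close>

lemma compact_unit_sphere_sum_zero: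
  assumes "finite V"
  shows "compact {f :: 'v \<Rightarrow> real. (\<forall>v. v \<notin> V \<longrightarrow> f v = 0) \<and> (\<Sum>v\<in>V. (f v)\<^sup>2) = 1 \<and> (\<Sum>v\<in>V. f v) = 0}"
    (is "compact ?K")
proof -
  let ?B = "PiE UNIV (\<lambda>v. if v \<in> V then {-1..1} else {0}) :: ('v \<Rightarrow> real) set"
  let ?C = "{f :: 'v \<Rightarrow> real. (\<Sum>v\<in>V. (f v)\<^sup>2) = 1} \<inter> {f. (\<Sum>v\<in>V. f v) = 0}"
  have "compactin (product_topology (\<lambda>_. euclidean) UNIV) ?B"
    by (subst compactin_PiE) auto
  then have "compact ?B"
    by (simp add: euclidean_product_topology)
  moreover have "closed ?C"
    by (intro closed_Int closed_Collect_eq continuous_on_sum continuous_on_power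
        continuous_on_const continuous_on_product_coordinates)
  moreover have "?K = ?B \<inter> ?C"
  proof -
    have "f v \<in> {-1..1}" if "(\<Sum>v\<in>V. (f v)\<^sup>2) = 1" "v \<in> V" for f :: "'v \<Rightarrow> real" and v
    proof -
      have "(f v)\<^sup>2 \<le> (\<Sum>v\<in>V. (f v)\<^sup>2)"
        using that assms by (intro member_le_sum) auto
      then show ?thesis using that by (simp add: abs_square_le_1 abs_le_iff)
    qed
    then show ?thesis by (auto simp: PiE_def Pi_def)
  qed
  ultimately show ?thesis by (simp add: compact_Int_closed)
qed

text \<open>The quadratic form attains its maximum on the unit sphere of sum-zero vectors. A
  first-variation argument shows that the maximiser is an eigenvector with the maximum as
  eigenvalue.\<close>

lemma rayleigh_le_spectral_lambda:
  assumes V: "finite V" and sym: "symmetric_on V M"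
    and rows: "\<And>v. v \<in> V \<Longrightarrow> (\<Sum>w\<in>V. M v w) = 1"
    and f0: "(\<Sum>v\<in>V. f v) = 0"
  shows "(\<Sum>v\<in>V. f v * mat_vec V M f v) \<le> spectral_lambda V M * (\<Sum>v\<in>V. (f v)\<^sup>2)"
proof (cases "(\<Sum>v\<in>V. (f v)\<^sup>2) = 0")
  case True
  then have "\<forall>v\<in>V. f v = 0" using V by (simp add: sum_nonneg_eq_0_iff)
  then show ?thesis by simp
next
  case False
  define q where "q g = (\<Sum>v\<in>V. g v * mat_vec V M g v)" for g
  define N where "N g = (\<Sum>v\<in>V. (g v)\<^sup>2)" for g :: "'a \<Rightarrow> real"
  let ?K = "{g :: 'a \<Rightarrow> real. (\<forall>v. v \<notin> V \<longrightarrow> g v = 0) \<and> (\<Sum>v\<in>V. (g v)\<^sup>2) = 1 \<and> (\<Sum>v\<in>V. g v) = 0}"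
  \<comment> \<open>Cutting off outside \<open>V\<close> is part of the normalisation, because
    \<open>f\<close> is not assumed to vanish there while elements of \<open>?K\<close>
    must.\<close>
  define nrm where "nrm g = (\<lambda>v. if v \<in> V then g v / sqrt (N g) else 0)" for g
  have nrm: "nrm g \<in> ?K" "q (nrm g) = q g / N g" if "N g \<noteq> 0" "(\<Sum>v\<in>V. g v) = 0" for g
  proof -
    have "N g > 0" using that by (simp add: N_def sum_nonneg order_less_le)
    then show "nrm g \<in> ?K"
      using that by (simp add: nrm_def power_divide flip: sum_divide_distrib) (simp add: N_def)
    have "mat_vec V M (nrm g) v = mat_vec V M g v / sqrt (N g)" for v
      by (simp add: mat_vec_def nrm_def sum_divide_distrib)
    then have "q (nrm g) = (\<Sum>v\<in>V. (g v / sqrt (N g)) * (mat_vec V M g v / sqrt (N g)))"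
      by (simp add: q_def nrm_def)
    also have "\<dots> = q g / N g"
      using \<open>N g > 0\<close> by (simp add: q_def sum_divide_distrib)
    finally show "q (nrm g) = q g / N g" .
  qed
  have "continuous_on ?K q"
    unfolding q_def mat_vec_def
    by (intro continuous_on_sum continuous_on_mult continuous_on_const
        continuous_on_subset[OF continuous_on_product_coordinates]) auto
  moreover have "?K \<noteq> {}" using nrm(1)[of f] False f0 by (auto simp: N_def)
  ultimately have "\<exists>h\<in>?K. \<forall>g\<in>?K. q g \<le> q h"
    by (intro continuous_attains_sup compact_unit_sphere_sum_zero V)
  then obtain h where h: "h \<in> ?K" and hmax: "\<And>g. g \<in> ?K \<Longrightarrow> q g \<le> q h"
    by blast
  define m where "m = q h"
  \<comment> \<open>Both sides are homogeneous of degree two, so the bound spreads from the sphere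
    to all sum-zero vectors.\<close>
  have max: "q g \<le> m * N g" if "(\<Sum>v\<in>V. g v) = 0" for g
  proof (cases "N g = 0")
    case True
    then have "\<forall>v\<in>V. g v = 0" using V by (simp add: N_def sum_nonneg_eq_0_iff)
    then show ?thesis by (simp add: q_def N_def)
  next
    case False
    then have "N g > 0" by (simp add: N_def sum_nonneg order_less_le)
    with nrm[OF False that] hmax[of "nrm g"] show ?thesis
      by (simp add: m_def divide_le_eq)
  qed
  have Nh: "N h = 1" and h0: "(\<Sum>v\<in>V. h v) = 0" using h by (auto simp: N_def)
  \<comment> \<open>The residual of the eigenvalue equation for \<open>h\<close>. It has entry sum
    \<open>0\<close> because \<open>M\<close> preserves entry sums, so \<open>h\<close> may be
    varied in this direction.\<close>
  define r where "r v = m * h v - mat_vec V M h v" for v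
  have r0: "(\<Sum>v\<in>V. r v) = 0"
    using sum_mat_vec[OF sym rows, of h] h0
    by (simp add: r_def sum_subtractf flip: sum_distrib_left)
  \<comment> \<open>First variation of \<open>m * N - q\<close>, which is nonnegative and vanishes at \<open>h\<close>, in direction \<open>r\<close>.\<close>
  have var: "0 \<le> 2 * t * N r + t\<^sup>2 * (m * N r - q r)" for t
  proof -
    let ?g = "\<lambda>v. h v + t * r v"
    have "q ?g = q h + t * (\<Sum>v\<in>V. h v * mat_vec V M r v) + t * (\<Sum>v\<in>V. r v * mat_vec V M h v) + t\<^sup>2 * q r"
      by (simp add: q_def mat_vec_add algebra_simps sum.distrib sum_distrib_left power2_eq_square)
    also have "(\<Sum>v\<in>V. h v * mat_vec V M r v) = (\<Sum>v\<in>V. r v * mat_vec V M h v)"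
      by (subst mat_vec_symmetric[OF sym]) (simp only: mult.commute)
    finally have q: "q ?g = q h + 2 * t * (\<Sum>v\<in>V. r v * mat_vec V M h v) + t\<^sup>2 * q r" by simp
    have N: "N ?g = N h + 2 * t * (\<Sum>v\<in>V. r v * h v) + t\<^sup>2 * N r"
      by (simp add: N_def algebra_simps sum.distrib sum_distrib_left power2_eq_square)
    have Nr: "N r = m * (\<Sum>v\<in>V. r v * h v) - (\<Sum>v\<in>V. r v * mat_vec V M h v)"
    proof -
      have "N r = (\<Sum>v\<in>V. r v * (m * h v - mat_vec V M h v))"
        by (simp add: N_def r_def power2_eq_square)
      then show ?thesis
        by (simp add: right_diff_distrib sum_subtractf sum_distrib_left mult.left_commute)
    qed
    have "q ?g \<le> m * N ?g"
      by (rule max) (simp add: sum.distrib h0 r0 flip: sum_distrib_left)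
    then have "0 \<le> m * N ?g - q ?g" by simp
    also have "\<dots> = 2 * t * (m * (\<Sum>v\<in>V. r v * h v) - (\<Sum>v\<in>V. r v * mat_vec V M h v))
        + t\<^sup>2 * (m * N r - q r)"
      unfolding q N Nh by (simp add: m_def algebra_simps)
    finally show ?thesis by (simp only: Nr[symmetric])
  qed
  have "N r = 0"
  proof (rule ccontr)
    assume "N r \<noteq> 0"
    then have p: "N r > 0" by (simp add: N_def sum_nonneg order_less_le)
    \<comment> \<open>Adding \<open>1\<close> keeps \<open>k\<close> positive. With
      \<open>t = - (N r / k)\<close> the linear term outweighs the quadratic one and leaves at most
      \<open>- ((N r)\<^sup>2 / k)\<close>.\<close>
    define k where "k = \<bar>m * N r - q r\<bar> + 1"
    have k: "k > 0" "m * N r - q r \<le> k" by (auto simp: k_def)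
    have "0 \<le> 2 * (- (N r / k)) * N r + (- (N r / k))\<^sup>2 * (m * N r - q r)"
      by (rule var)
    also have "\<dots> \<le> 2 * (- (N r / k)) * N r + (- (N r / k))\<^sup>2 * k"
      using k by (intro add_left_mono mult_left_mono) auto
    also have "\<dots> = - ((N r)\<^sup>2 / k)"
      using k by (simp add: power2_eq_square field_simps)
    also have "\<dots> < 0" using p k by simp
    finally show False by simp
  qed
  then have "\<forall>v\<in>V. r v = 0" using V by (simp add: N_def sum_nonneg_eq_0_iff)
  then have "h \<in> eigenspace V M m" using h by (simp add: mem_eigenspace_iff r_def)
  moreover have "h \<noteq> 0" using Nh by (auto simp: N_def)
  ultimately have "\<bar>m\<bar> \<le> spectral_lambda V M"
    using eigenvalue_le_spectral_lambda[OF V sym rows] h0 by blast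
  then have "m * N f \<le> spectral_lambda V M * N f"
    by (intro mult_right_mono) (auto simp: N_def sum_nonneg)
  with max[OF f0] show ?thesis by (simp add: q_def N_def)
qed

section \<open>Normalized adjacency matrices and products\<close>

lemma mat_vec_norm_adj:
  assumes "finite V"
  shows "mat_vec V (norm_adj V adj) f v = (\<Sum>w | w \<in> V \<and> adj v w. f w) / card {w \<in> V. adj v w}"
proof -
  have "mat_vec V (norm_adj V adj) f v
      = (\<Sum>w\<in>V. if adj v w then f w / card {w \<in> V. adj v w} else 0)"
    by (auto simp: mat_vec_def norm_adj_def intro!: sum.cong)
  also have "\<dots> = (\<Sum>w | w \<in> V \<and> adj v w. f w / card {w \<in> V. adj v w})"
    using assms by (rule sum.inter_filter[symmetric])
  finally show ?thesis by (simp add: sum_divide_distrib)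
qed

lemma norm_adj_row_sum:
  assumes "finite V" and "card {w \<in> V. adj v w} > 0"
  shows "(\<Sum>w\<in>V. norm_adj V adj v w) = 1"
  using mat_vec_norm_adj[OF assms(1), of adj "\<lambda>_. 1" v] assms(2)
  by (simp add: mat_vec_def)

lemma symmetric_on_norm_adj:
  assumes "\<And>v w. adj v w \<longleftrightarrow> adj w v" and "\<And>v. v \<in> V \<Longrightarrow> card {w \<in> V. adj v w} = k"
  shows "symmetric_on V (norm_adj V adj)"
  unfolding symmetric_on_def norm_adj_def using assms by simp

lemma mat_vec_mat_prod: "mat_vec V (mat_prod V M N) f v = mat_vec V M (mat_vec V N f) v"
proof -
  have "mat_vec V (mat_prod V M N) f v = (\<Sum>w\<in>V. \<Sum>u\<in>V. M v u * (N u w * f w))"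
    by (simp add: mat_vec_def mat_prod_def sum_distrib_right mult.assoc)
  also have "\<dots> = (\<Sum>u\<in>V. \<Sum>w\<in>V. M v u * (N u w * f w))"
    by (rule sum.swap)
  finally show ?thesis by (simp add: mat_vec_def sum_distrib_left)
qed

text \<open>Transposition reverses a product, and \<open>M N M\<close> is a palindrome; the zig-zag
  matrix has this shape.\<close>

lemma symmetric_on_conj:
  assumes "symmetric_on V M" and "symmetric_on V N"
  shows "symmetric_on V (mat_prod V M (mat_prod V N M))"
  unfolding symmetric_on_def
proof (intro ballI)
  fix v w assume vw: "v \<in> V" "w \<in> V"
  have "mat_prod V M (mat_prod V N M) v w = (\<Sum>u\<in>V. \<Sum>t\<in>V. M v u * (N u t * M t w))"
    by (simp add: mat_prod_def sum_distrib_left)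
  also have "\<dots> = (\<Sum>t\<in>V. \<Sum>u\<in>V. M v u * (N u t * M t w))"
    by (rule sum.swap)
  also have "\<dots> = (\<Sum>t\<in>V. \<Sum>u\<in>V. M w t * (N t u * M u v))"
    using assms vw by (auto simp: symmetric_on_def intro!: sum.cong)
  finally show "mat_prod V M (mat_prod V N M) v w = mat_prod V M (mat_prod V N M) w v"
    by (simp add: mat_prod_def sum_distrib_left)
qed

section \<open>Lifting the walk to the zig-zag product\<close>

locale commutative_triplet = group G for G (structure) +
  fixes S :: "'a set set"
  assumes finite_carrier: "finite (carrier G)"
    and triple: "\<sigma> \<in> S \<Longrightarrow> \<sigma> \<subseteq> carrier G \<and> card \<sigma> = 3"
    and cts: "commutative_triplet_structure G S"
begin

section \<open>Types and the blue matching\<close>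

abbreviation "verts \<equiv> zigzag_verts G S"

lemma pair_types_subset: "\<tau> \<in> pair_types S \<Longrightarrow> \<tau> \<subseteq> carrier G"
  using triple by (force simp: pair_types_def)

text \<open>Commutativity is (E). The product differs from \<open>\<one>\<close> by (0), as
  otherwise \<open>b = inv a\<close>.\<close>

lemma pair_type_cases:
  assumes "\<tau> \<in> pair_types S"
  obtains a b where "\<tau> = {a, b}" and "a \<noteq> b" and "a \<in> carrier G" and "b \<in> carrier G"
    and "a \<otimes> b = b \<otimes> a" and "a \<otimes> b \<noteq> \<one>"
proof -
  from assms obtain a b where ab: "\<tau> = {a, b}" "a \<noteq> b"
    by (auto simp: pair_types_def card_2_iff)
  then have c: "a \<in> carrier G" "b \<in> carrier G"
    using pair_types_subset[OF assms] by auto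
  have comm: "a \<otimes> b = b \<otimes> a"
    using cts assms ab by (auto simp: commutative_triplet_structure_def cond_E_def)
  have "a \<otimes> b \<noteq> \<one>"
  proof
    assume "a \<otimes> b = \<one>"
    then have "b = inv a" using c comm by (metis inv_equality)
    with cts assms ab c show False
      by (auto simp: commutative_triplet_structure_def cond_0_def)
  qed
  with that ab c comm show ?thesis by blast
qed

lemma finite_triples: "finite S"
  by (rule finite_subset[of _ "Pow (carrier G)"]) (use triple finite_carrier in auto)

lemma finite_pair_types: "finite (pair_types S)"
  by (rule finite_subset[of _ "Pow (carrier G)"]) (use pair_types_subset finite_carrier in auto)

lemma finite_verts: "finite verts"
  by (simp add: zigzag_verts_def finite_carrier finite_pair_types)

text \<open>By (E) both orderings of the pair give the same product, so the description in
  \<open>type_prod\<close> is unique.\<close>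

lemma type_prod_pair:
  assumes "{a, b} \<in> pair_types S" and "a \<noteq> b"
  shows "type_prod G {a, b} = a \<otimes> b"
proof -
  have "a \<otimes> b = b \<otimes> a"
    using cts assms by (auto simp: commutative_triplet_structure_def cond_E_def)
  then have "p = a \<otimes> b" if "\<exists>c d. c \<noteq> d \<and> {a, b} = {c, d} \<and> p = c \<otimes> d" for p
    using that by (auto simp: doubleton_eq_iff)
  then show ?thesis
    unfolding type_prod_def using assms(2) by (intro the_equality) blast+
qed

lemma inv_pair_type:
  assumes "{a, b} \<in> pair_types S"
  shows "{inv a, inv b} \<in> pair_types S"
proof -
  have "(inv b, inv a) \<in> ordered_types S"
    using cts assms by (auto simp: commutative_triplet_structure_def cond_A_def ordered_types_def)
  then show ?thesis by (simp add: ordered_types_def insert_commute)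
qed

lemma blue_map_pair:
  assumes "{a, b} \<in> pair_types S" and "a \<noteq> b"
  shows "blue_map G (g, {a, b}) = (a \<otimes> b \<otimes> g, {inv a, inv b})"
  by (simp add: blue_map_def type_prod_pair assms)

lemma vert_cases:
  assumes "x \<in> verts"
  obtains g a b where "x = (g, {a, b})" and "a \<noteq> b" and "{a, b} \<in> pair_types S"
    and "g \<in> carrier G" and "a \<in> carrier G" and "b \<in> carrier G"
    and "a \<otimes> b = b \<otimes> a" and "a \<otimes> b \<noteq> \<one>"
    and "blue_map G x = (a \<otimes> b \<otimes> g, {inv a, inv b})"
proof -
  from assms obtain g \<tau> where x: "x = (g, \<tau>)" "g \<in> carrier G" "\<tau> \<in> pair_types S"
    by (auto simp: zigzag_verts_def)
  from pair_type_cases[OF x(3)] obtain a b where "\<tau> = {a, b}" "a \<noteq> b" "a \<in> carrier G"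
    "b \<in> carrier G" "a \<otimes> b = b \<otimes> a" "a \<otimes> b \<noteq> \<one>" by blast
  with that x blue_map_pair[of a b g] show ?thesis by blast
qed

lemma blue_map_in_verts:
  assumes "x \<in> verts"
  shows "blue_map G x \<in> verts"
  using assms by (rule vert_cases) (simp add: zigzag_verts_def inv_pair_type)

text \<open>Since \<open>a\<close> and \<open>b\<close> commute, the product of the inverted type is
  \<open>inv (a \<otimes> b)\<close>, which undoes the first translation.\<close>

lemma blue_map_involution:
  assumes "x \<in> verts"
  shows "blue_map G (blue_map G x) = x"
proof -
  from assms obtain g a b where x: "x = (g, {a, b})" "a \<noteq> b" "{a, b} \<in> pair_types S"
    "g \<in> carrier G" "a \<in> carrier G" "b \<in> carrier G" "a \<otimes> b = b \<otimes> a" "a \<otimes> b \<noteq> \<one>"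
    "blue_map G x = (a \<otimes> b \<otimes> g, {inv a, inv b})"
    by (rule vert_cases)
  have "inv a \<noteq> inv b" using x(2,5,6) inj_onD[OF inv_inj, of a b] by auto
  moreover have "inv a \<otimes> inv b \<otimes> (a \<otimes> b \<otimes> g) = g"
  proof -
    have "inv a \<otimes> inv b = inv (b \<otimes> a)"
      using x(5,6) by (simp add: inv_mult_group)
    then have "inv a \<otimes> inv b = inv (a \<otimes> b)"
      by (simp only: x(7))
    then show ?thesis
      using x(4-6) m_assoc[of "inv (a \<otimes> b)" "a \<otimes> b" g, symmetric] by simp
  qed
  ultimately show ?thesis
    unfolding x(9) using blue_map_pair[OF inv_pair_type[OF x(3)]] by (simp add: x(1,5,6))
qed

text \<open>Follows from \<open>a \<otimes> b \<noteq> \<one>\<close>. Blue steps thus have no fixed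
  points and always change the group component.\<close>

lemma fst_blue_map_neq:
  assumes "x \<in> verts"
  shows "fst (blue_map G x) \<noteq> fst x"
  using assms by (rule vert_cases) simp

section \<open>The map onto the skeleton and its fibres\<close>

definition edge_of :: "'a \<times> 'a set \<Rightarrow> 'a set" where
  "edge_of x = (\<lambda>s. s \<otimes> fst x) ` snd x"

text \<open>The blue step only swaps the endpoints: \<open>inv a\<close> sends
  \<open>a \<otimes> b \<otimes> g\<close> to \<open>b \<otimes> g\<close>, and, by commutativity,
  \<open>inv b\<close> sends it to \<open>a \<otimes> g\<close>.\<close>

lemma edge_of_blue_map:
  assumes "x \<in> verts"
  shows "edge_of (blue_map G x) = edge_of x"
proof -
  from assms obtain g a b where x: "x = (g, {a, b})"
    "g \<in> carrier G" "a \<in> carrier G" "b \<in> carrier G" "a \<otimes> b = b \<otimes> a"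
    "blue_map G x = (a \<otimes> b \<otimes> g, {inv a, inv b})"
    by (rule vert_cases)
  have cancel: "inv s \<otimes> (s \<otimes> t \<otimes> g) = t \<otimes> g" if "s \<in> carrier G" "t \<in> carrier G" for s t
    using that x(2) by (simp add: m_assoc[symmetric])
  have "inv a \<otimes> (a \<otimes> b \<otimes> g) = b \<otimes> g" "inv b \<otimes> (a \<otimes> b \<otimes> g) = a \<otimes> g"
    using cancel[of a b] cancel[of b a] x(3-5) by simp_all
  then show ?thesis unfolding x(6) by (simp add: x(1) edge_of_def insert_commute)
qed

lemma mult_right_inj_on: "g \<in> carrier G \<Longrightarrow> A \<subseteq> carrier G \<Longrightarrow> inj_on (\<lambda>s. s \<otimes> g) A"
  by (rule inj_onI) (metis right_cancel subsetD)

text \<open>The quotient \<open>a b\<^sup>-\<^sup>1\<close> can be read off the edge \<open>{a g, b g}\<close>, so (B) determines the two lifts.\<close>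

lemma edge_of_eq_cases:
  assumes "x \<in> verts" and "y \<in> verts" and "edge_of x = edge_of y"
  shows "y = x \<or> y = blue_map G x"
proof -
  from assms(1) obtain g a b where x: "x = (g, {a, b})" "a \<noteq> b" "{a, b} \<in> pair_types S"
    "g \<in> carrier G" "a \<in> carrier G" "b \<in> carrier G" "a \<otimes> b = b \<otimes> a"
    "blue_map G x = (a \<otimes> b \<otimes> g, {inv a, inv b})"
    by (rule vert_cases)
  from assms(2) obtain h c d where y: "y = (h, {c, d})" "c \<noteq> d" "{c, d} \<in> pair_types S"
    "h \<in> carrier G" "c \<in> carrier G" "d \<in> carrier G" "c \<otimes> d = d \<otimes> c"
    by (rule vert_cases)
  \<comment> \<open>Stated for a fixed matching of endpoints. Edges being unordered, it is applied
    to \<open>c\<close>, \<open>d\<close> in both orders.\<close>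
  have main: "y = x \<or> y = blue_map G x"
    if y: "y = (h, {c, d})" "{c, d} \<in> pair_types S" "c \<in> carrier G" "d \<in> carrier G"
      and eq: "a \<otimes> g = c \<otimes> h" "b \<otimes> g = d \<otimes> h" for c d
  proof -
    have quot: "s \<otimes> inv t = (s \<otimes> k) \<otimes> inv (t \<otimes> k)"
      if "s \<in> carrier G" "t \<in> carrier G" "k \<in> carrier G" for s t k
    proof -
      have "(s \<otimes> k) \<otimes> inv (t \<otimes> k) = s \<otimes> (k \<otimes> inv k) \<otimes> inv t"
        using that by (simp only: inv_mult_group m_assoc m_closed inv_closed)
      with that show ?thesis by simp
    qed
    have "a \<otimes> inv b = c \<otimes> inv d"
      using quot[of a b g] quot[of c d h] eq x y \<open>h \<in> carrier G\<close> by simp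
    moreover have "(a, b) \<in> ordered_types S" "(c, d) \<in> ordered_types S"
      using x y by (auto simp: ordered_types_def)
    ultimately have "(c, d) = (a, b) \<or> d = inv a \<and> c = inv b"
      using cts unfolding commutative_triplet_structure_def cond_B_def by (metis fst_conv snd_conv)
    then show ?thesis
    proof
      assume "(c, d) = (a, b)"
      then have "h = g" using eq x \<open>h \<in> carrier G\<close> by (metis Pair_inject Units_eq Units_l_cancel)
      with \<open>(c, d) = (a, b)\<close> x y show ?thesis by simp
    next
      assume cd: "d = inv a \<and> c = inv b"
      have "h = b \<otimes> (inv b \<otimes> h)"
        using x \<open>h \<in> carrier G\<close> by (simp add: m_assoc[symmetric])
      also have "\<dots> = b \<otimes> (a \<otimes> g)"
        using eq cd by simp
      also have "\<dots> = a \<otimes> b \<otimes> g"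
        using x by (simp add: m_assoc[symmetric])
      finally show ?thesis using x y cd by (simp add: insert_commute)
    qed
  qed
  have "{a \<otimes> g, b \<otimes> g} = {c \<otimes> h, d \<otimes> h}"
    using assms(3) x y by (simp add: edge_of_def)
  then show ?thesis
    using main[of c d] main[of d c] y by (auto simp: doubleton_eq_iff insert_commute)
qed

lemma edge_of_fibre:
  assumes "x \<in> verts"
  shows "{y \<in> verts. edge_of y = edge_of x} = {x, blue_map G x}"
  using edge_of_eq_cases[OF assms] edge_of_blue_map[OF assms] blue_map_in_verts[OF assms] assms
  by auto

lemma subset_translate_pair_type:
  assumes "\<sigma> \<in> S" and "g \<in> carrier G" and "e \<subseteq> (\<lambda>s. s \<otimes> g) ` \<sigma>" and "card e = 2"
  obtains \<tau> where "\<tau> \<subseteq> \<sigma>" and "\<tau> \<in> pair_types S" and "e = edge_of (g, \<tau>)"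
proof -
  from assms(3) obtain \<tau> where \<tau>: "\<tau> \<subseteq> \<sigma>" "e = (\<lambda>s. s \<otimes> g) ` \<tau>"
    by (auto simp: subset_image_iff)
  have "\<tau> \<subseteq> carrier G" using \<tau> triple assms(1) by blast
  then have "card \<tau> = 2"
    using assms(4) \<tau>(2) card_image[OF mult_right_inj_on[OF assms(2)]] by simp
  with \<tau> assms(1) that show ?thesis by (auto simp: pair_types_def edge_of_def)
qed

lemma edge_of_in_skeleton:
  assumes "x \<in> verts"
  shows "edge_of x \<in> skeleton G S"
proof -
  obtain g \<tau> where x: "x = (g, \<tau>)" "g \<in> carrier G" "\<tau> \<in> pair_types S"
    using assms by (auto simp: zigzag_verts_def)
  then obtain \<sigma> where "\<sigma> \<in> S" "\<tau> \<subseteq> \<sigma>" "card \<tau> = 2" by (auto simp: pair_types_def)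
  moreover have "card (edge_of x) = card \<tau>"
    using x by (simp add: edge_of_def card_image mult_right_inj_on pair_types_subset)
  moreover have "(\<lambda>s. s \<otimes> g) ` \<sigma> \<in> triples G S"
    using x \<open>\<sigma> \<in> S\<close> by (auto simp: triples_def)
  moreover have "edge_of x \<subseteq> (\<lambda>s. s \<otimes> g) ` \<sigma>"
    using x \<open>\<tau> \<subseteq> \<sigma>\<close> by (auto simp: edge_of_def)
  ultimately show ?thesis by (auto simp: skeleton_def)
qed

lemma skeleton_eq: "skeleton G S = edge_of ` verts"
proof
  show "skeleton G S \<subseteq> edge_of ` verts"
  proof
    fix e assume "e \<in> skeleton G S"
    then obtain g \<sigma> where e: "card e = 2" "g \<in> carrier G" "\<sigma> \<in> S" "e \<subseteq> (\<lambda>s. s \<otimes> g) ` \<sigma>"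
      by (auto simp: skeleton_def triples_def)
    then obtain \<tau> where "\<tau> \<in> pair_types S" "e = edge_of (g, \<tau>)"
      by (metis subset_translate_pair_type)
    with e show "e \<in> edge_of ` verts" by (auto simp: zigzag_verts_def)
  qed
qed (use edge_of_in_skeleton in blast)

lemma finite_skeleton: "finite (skeleton G S)"
  by (simp add: skeleton_eq finite_verts)

section \<open>Degrees in the link\<close>

text \<open>Two distinct pairs have at least three elements in their union, which fills the triple.
  Adjacent types therefore determine the triple.\<close>

lemma link_adj_union:
  assumes "link_adj S \<tau> \<tau>'" and "\<sigma> \<in> S" and "\<tau> \<union> \<tau>' \<subseteq> \<sigma>"
  shows "\<tau> \<union> \<tau>' = \<sigma>"
proof (rule card_seteq)
  have \<sigma>: "finite \<sigma>" "card \<sigma> = 3"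
    using triple[OF assms(2)] by (auto intro: card_ge_0_finite)
  then show "finite \<sigma>" by simp
  have "finite \<tau>" "finite \<tau>'" using \<sigma> assms(3) finite_subset by auto
  moreover have "card \<tau> = 2" "card \<tau>' = 2" "\<tau> \<noteq> \<tau>'"
    using assms(1) by (auto simp: link_adj_def pair_types_def)
  ultimately have "\<tau> \<subset> \<tau> \<union> \<tau>'"
    by (metis card_subset_eq psubsetI sup_ge1 sup_ge2)
  then have "card \<tau> < card (\<tau> \<union> \<tau>')"
    using \<open>finite \<tau>\<close> \<open>finite \<tau>'\<close> by (intro psubset_card_mono) auto
  with \<open>card \<tau> = 2\<close> \<sigma> show "card \<sigma> \<le> card (\<tau> \<union> \<tau>')" by simp
qed (use assms in auto)

text \<open>Each triple over \<open>\<tau>\<close> contributes its two other pairs, and different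
  triples contribute disjoint sets by \<open>link_adj_union\<close>.\<close>

lemma link_degree:
  assumes "\<tau> \<in> pair_types S"
  shows "card {\<tau>'. link_adj S \<tau> \<tau>'} = 2 * card {\<sigma> \<in> S. \<tau> \<subseteq> \<sigma>}"
proof -
  let ?N = "\<lambda>\<sigma>. {\<tau>'. \<tau>' \<subseteq> \<sigma> \<and> card \<tau>' = 2} - {\<tau>}"
  have eq: "{\<tau>'. link_adj S \<tau> \<tau>'} = (\<Union>\<sigma>\<in>{\<sigma> \<in> S. \<tau> \<subseteq> \<sigma>}. ?N \<sigma>)"
    using assms by (auto simp: link_adj_def pair_types_def)
  have fin: "finite \<sigma>" "card \<sigma> = 3" if "\<sigma> \<in> S" for \<sigma>
    using triple[OF that] by (auto intro: card_ge_0_finite)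
  have "card {\<tau>'. link_adj S \<tau> \<tau>'} = (\<Sum>\<sigma>\<in>{\<sigma> \<in> S. \<tau> \<subseteq> \<sigma>}. card (?N \<sigma>))"
    unfolding eq
  proof (rule card_UN_disjoint)
    show "finite {\<sigma> \<in> S. \<tau> \<subseteq> \<sigma>}" using finite_triples by simp
    show "\<forall>\<sigma>\<in>{\<sigma> \<in> S. \<tau> \<subseteq> \<sigma>}. finite (?N \<sigma>)"
      using fin by (auto intro!: finite_subset[OF _ finite_Pow_iff[THEN iffD2]])
    have un: "\<tau> \<union> \<tau>' = \<sigma>" if "\<sigma> \<in> S" "\<tau> \<subseteq> \<sigma>" "\<tau>' \<in> ?N \<sigma>" for \<sigma> \<tau>'
      using link_adj_union[of \<tau> \<tau>' \<sigma>] that assms eq by auto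
    have "\<sigma> = \<rho>"
      if "\<sigma> \<in> {\<sigma> \<in> S. \<tau> \<subseteq> \<sigma>}" "\<rho> \<in> {\<sigma> \<in> S. \<tau> \<subseteq> \<sigma>}" "\<tau>' \<in> ?N \<sigma> \<inter> ?N \<rho>" for \<sigma> \<rho> \<tau>'
      using un[of \<sigma> \<tau>'] un[of \<rho> \<tau>'] that by simp
    then show "\<forall>\<sigma>\<in>{\<sigma> \<in> S. \<tau> \<subseteq> \<sigma>}. \<forall>\<rho>\<in>{\<sigma> \<in> S. \<tau> \<subseteq> \<sigma>}. \<sigma> \<noteq> \<rho> \<longrightarrow> ?N \<sigma> \<inter> ?N \<rho> = {}"
      by (intro ballI impI equals0I) (rule notE)
  qed
  also have "\<dots> = (\<Sum>\<sigma>\<in>{\<sigma> \<in> S. \<tau> \<subseteq> \<sigma>}. 2)"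
  proof (rule sum.cong)
    fix \<sigma> assume \<sigma>: "\<sigma> \<in> {\<sigma> \<in> S. \<tau> \<subseteq> \<sigma>}"
    then have "card {\<tau>'. \<tau>' \<subseteq> \<sigma> \<and> card \<tau>' = 2} = 3"
      using n_subsets[of \<sigma> 2] fin by (simp add: numeral_eq_Suc)
    moreover have "\<tau> \<in> {\<tau>'. \<tau>' \<subseteq> \<sigma> \<and> card \<tau>' = 2}"
      using \<sigma> assms by (auto simp: pair_types_def)
    ultimately show "card (?N \<sigma>) = 2" by simp
  qed simp
  finally show ?thesis by simp
qed

text \<open>The degree is twice the constant of (C), positive because every type lies in some
  triple. Without types any positive \<open>k\<close> will do.\<close>

lemma link_regular:
  "\<exists>k>0. \<forall>\<tau>\<in>pair_types S. card {\<tau>'. link_adj S \<tau> \<tau>'} = k"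
proof (cases "pair_types S = {}")
  case True
  then show ?thesis by auto
next
  case False
  then obtain \<tau> where \<tau>: "\<tau> \<in> pair_types S" by blast
  then have "{\<sigma> \<in> S. \<tau> \<subseteq> \<sigma>} \<noteq> {}" by (auto simp: pair_types_def)
  then have pos: "card {\<sigma> \<in> S. \<tau> \<subseteq> \<sigma>} > 0" using finite_triples by (simp add: card_gt_0_iff)
  obtain d where "\<forall>\<tau>\<in>pair_types S. card {\<sigma> \<in> S. \<tau> \<subseteq> \<sigma>} = d"
    using cts by (auto simp: commutative_triplet_structure_def cond_C_def)
  with \<tau> pos have "2 * d > 0" "\<forall>\<tau>\<in>pair_types S. card {\<tau>'. link_adj S \<tau> \<tau>'} = 2 * d"
    by (simp_all add: link_degree)
  then show ?thesis by blast
qed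

lemma link_adj_sym: "link_adj S \<tau> \<tau>' \<longleftrightarrow> link_adj S \<tau>' \<tau>"
  by (auto simp: link_adj_def Un_commute)

section \<open>Red neighbourhoods and walk neighbourhoods\<close>

lemma red_nbrs_eq:
  assumes "x \<in> verts"
  shows "{y \<in> verts. red_adj S x y} = Pair (fst x) ` {\<tau>'. link_adj S (snd x) \<tau>'}"
proof -
  have "\<tau>' \<in> pair_types S" if "link_adj S (snd x) \<tau>'" for \<tau>'
    using that by (simp add: link_adj_def)
  with assms show ?thesis by (auto simp: red_adj_def zigzag_verts_def)
qed

text \<open>Adjacent types share exactly one element, since \<open>2 + 2 - 3 = 1\<close>; by (E) it
  can be written as the left factor of both products and cancelled.\<close>

lemma link_adj_type_prod_neq:
  assumes "link_adj S \<tau> \<tau>'"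
  shows "type_prod G \<tau> \<noteq> type_prod G \<tau>'"
proof
  assume eq: "type_prod G \<tau> = type_prod G \<tau>'"
  from assms obtain \<sigma> where \<sigma>: "\<sigma> \<in> S" "\<tau> \<union> \<tau>' \<subseteq> \<sigma>" by (auto simp: link_adj_def)
  have T: "\<tau> \<in> pair_types S" "\<tau>' \<in> pair_types S" "\<tau> \<noteq> \<tau>'" "card \<tau> = 2" "card \<tau>' = 2"
    using assms by (auto simp: link_adj_def pair_types_def)
  have "finite \<tau>" "finite \<tau>'" using T by (auto intro: card_ge_0_finite)
  then have "card (\<tau> \<inter> \<tau>') = 1"
    using card_Un_Int[of \<tau> \<tau>'] T link_adj_union[OF assms \<sigma>] triple[OF \<sigma>(1)] by simp
  then obtain a where "a \<in> \<tau>" "a \<in> \<tau>'" by (auto simp: card_1_singleton_iff)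
  with T(4,5) obtain b c where bc: "\<tau> = {a, b}" "\<tau>' = {a, c}" "a \<noteq> b" "a \<noteq> c"
    by (auto simp: card_2_iff)
  then have "a \<otimes> b = a \<otimes> c" using eq T type_prod_pair by metis
  moreover have "a \<in> carrier G" "b \<in> carrier G" "c \<in> carrier G"
    using bc T pair_types_subset by auto
  ultimately have "b = c" by simp
  with bc T show False by simp
qed

text \<open>Only blue partners can collide. They differ in the group component, so one would
  neighbour \<open>x\<close> and the other \<open>blue_map G x\<close>; comparing group components
  then equates the products of two adjacent types.\<close>

lemma inj_on_edge_of_red_nbrs:
  assumes "x \<in> verts"
  shows "inj_on edge_of ({y \<in> verts. red_adj S x y} \<union> {y \<in> verts. red_adj S (blue_map G x) y})"
    (is "inj_on _ (?A \<union> ?B)")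
proof (rule inj_onI)
  fix y z assume y: "y \<in> ?A \<union> ?B" and z: "z \<in> ?A \<union> ?B" and eq: "edge_of y = edge_of z"
  from y z have V: "y \<in> verts" "z \<in> verts" by auto
  have "z \<noteq> blue_map G y"
  proof
    assume zb: "z = blue_map G y"
    then have ne: "fst z \<noteq> fst y" using fst_blue_map_neq V by simp
    have key: False if "w \<in> ?A" "blue_map G w \<in> ?B" for w
    proof -
      have "w \<in> verts" and w: "fst w = fst x" "link_adj S (snd x) (snd w)"
        using that(1) by (auto simp: red_adj_def)
      have "type_prod G (snd w) \<otimes> fst x = type_prod G (snd x) \<otimes> fst x"
        using that(2) w by (auto simp: red_adj_def blue_map_def)
      moreover have "type_prod G (snd u) \<in> carrier G" if "u \<in> verts" for u
        using that by (rule vert_cases) (simp add: type_prod_pair)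
      ultimately have "type_prod G (snd w) = type_prod G (snd x)"
        using assms \<open>w \<in> verts\<close> by (auto simp: zigzag_verts_def)
      with link_adj_type_prod_neq[OF w(2)] show False by simp
    qed
    have yb: "y = blue_map G z" using zb V blue_map_involution by simp
    \<comment> \<open>The group component is constant on each of \<open>?A\<close> and
      \<open>?B\<close>, so \<open>y\<close> and \<open>z\<close> cannot lie in the same
      one.\<close>
    have "y \<in> ?A \<and> z \<in> ?B \<or> z \<in> ?A \<and> y \<in> ?B"
      using y z ne by (auto simp: red_adj_def)
    then show False
    proof (elim disjE conjE)
      assume "y \<in> ?A" and "z \<in> ?B"
      then show False unfolding zb by (rule key)
    next
      assume "z \<in> ?A" and "y \<in> ?B"
      then show False unfolding yb by (rule key)
    qed
  qed
  with edge_of_eq_cases[OF V eq] show "y = z" by simp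
qed

lemma edge_of_red_adj_walk_adj:
  assumes "x \<in> verts" and "y \<in> verts" and "red_adj S x y"
  shows "walk_adj G S (edge_of x) (edge_of y)"
proof -
  obtain g \<tau> \<tau>' where xy: "x = (g, \<tau>)" "y = (g, \<tau>')" "g \<in> carrier G" "link_adj S \<tau> \<tau>'"
    using assms by (auto simp: red_adj_def zigzag_verts_def)
  then obtain \<sigma> where \<sigma>: "\<sigma> \<in> S" "\<tau> \<union> \<tau>' \<subseteq> \<sigma>" by (auto simp: link_adj_def)
  have "(\<lambda>s. s \<otimes> g) ` \<sigma> \<in> triples G S" using \<sigma> xy by (auto simp: triples_def)
  moreover have "edge_of x \<union> edge_of y \<subseteq> (\<lambda>s. s \<otimes> g) ` \<sigma>"
    using \<sigma> xy by (auto simp: edge_of_def)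
  moreover have "edge_of x \<noteq> edge_of y"
  proof
    assume "edge_of x = edge_of y"
    then have "y = x \<or> y = blue_map G x"
      by (rule edge_of_eq_cases[OF assms(1,2)])
    moreover have "y \<noteq> blue_map G x"
      using fst_blue_map_neq[OF assms(1)] by (auto simp: xy(1,2) dest: sym)
    ultimately have "\<tau> = \<tau>'" using xy(1,2) by simp
    with xy show False by (simp add: link_adj_def)
  qed
  ultimately show ?thesis using assms edge_of_in_skeleton by (auto simp: walk_adj_def)
qed

text \<open>Two edges in a common triple lift to the same translate \<open>g\<close> with adjacent
  types. The lift of the first edge is \<open>x\<close> or its blue partner, whence the two red
  neighbourhoods.\<close>

lemma walk_nbrs_eq:
  assumes "x \<in> verts"
  shows "{e \<in> skeleton G S. walk_adj G S (edge_of x) e}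
    = edge_of ` ({y \<in> verts. red_adj S x y} \<union> {y \<in> verts. red_adj S (blue_map G x) y})"
    (is "_ = edge_of ` ?N")
proof
  have bx: "blue_map G x \<in> verts" using assms by (rule blue_map_in_verts)
  show "{e \<in> skeleton G S. walk_adj G S (edge_of x) e} \<subseteq> edge_of ` ?N"
  proof
    fix e assume "e \<in> {e \<in> skeleton G S. walk_adj G S (edge_of x) e}"
    then obtain g \<sigma> where e: "g \<in> carrier G" "\<sigma> \<in> S" "edge_of x \<noteq> e" "card (edge_of x) = 2"
        "card e = 2" and sub: "edge_of x \<subseteq> (\<lambda>s. s \<otimes> g) ` \<sigma>" "e \<subseteq> (\<lambda>s. s \<otimes> g) ` \<sigma>"
      by (auto simp: walk_adj_def triples_def skeleton_def)
    obtain \<tau> where \<tau>: "\<tau> \<subseteq> \<sigma>" "\<tau> \<in> pair_types S" "edge_of x = edge_of (g, \<tau>)"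
      using subset_translate_pair_type[OF e(2,1) sub(1) e(4)] by blast
    obtain \<tau>' where \<tau>': "\<tau>' \<subseteq> \<sigma>" "\<tau>' \<in> pair_types S" "e = edge_of (g, \<tau>')"
      using subset_translate_pair_type[OF e(2,1) sub(2) e(5)] by blast
    have "link_adj S \<tau> \<tau>'" using \<tau> \<tau>' e by (auto simp: link_adj_def)
    then have "red_adj S (g, \<tau>) (g, \<tau>')" by (simp add: red_adj_def)
    moreover have V: "(g, \<tau>) \<in> verts" "(g, \<tau>') \<in> verts" using \<tau> \<tau>' e by (auto simp: zigzag_verts_def)
    moreover have "(g, \<tau>) = x \<or> (g, \<tau>) = blue_map G x"
      using edge_of_eq_cases[OF assms V(1) \<tau>(3)] .
    ultimately have "(g, \<tau>') \<in> ?N" by auto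
    then show "e \<in> edge_of ` ?N" using \<tau>'(3) by blast
  qed
  show "edge_of ` ?N \<subseteq> {e \<in> skeleton G S. walk_adj G S (edge_of x) e}"
    using edge_of_red_adj_walk_adj[OF assms] edge_of_red_adj_walk_adj[OF bx] edge_of_in_skeleton
      edge_of_blue_map[OF assms] by auto
qed

text \<open>The two red neighbourhoods are disjoint because their group components differ. The
  general codomain serves both counting in \<open>nat\<close> and averaging in
  \<open>real\<close>.\<close>

lemma sum_walk_nbrs:
  fixes f :: "'a set \<Rightarrow> 'c::comm_monoid_add"
  assumes "x \<in> verts"
  shows "(\<Sum>e | e \<in> skeleton G S \<and> walk_adj G S (edge_of x) e. f e)
    = (\<Sum>y | y \<in> verts \<and> red_adj S x y. f (edge_of y))
      + (\<Sum>y | y \<in> verts \<and> red_adj S (blue_map G x) y. f (edge_of y))"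
proof -
  let ?A = "{y \<in> verts. red_adj S x y}" and ?B = "{y \<in> verts. red_adj S (blue_map G x) y}"
  have "(\<Sum>e | e \<in> skeleton G S \<and> walk_adj G S (edge_of x) e. f e) = (\<Sum>y\<in>?A \<union> ?B. f (edge_of y))"
    by (simp add: walk_nbrs_eq[OF assms] sum.reindex[OF inj_on_edge_of_red_nbrs[OF assms]])
  also have "\<dots> = (\<Sum>y\<in>?A. f (edge_of y)) + (\<Sum>y\<in>?B. f (edge_of y))"
    by (rule sum.union_disjoint)
      (use finite_verts fst_blue_map_neq[OF assms] in \<open>auto simp: red_adj_def\<close>)
  finally show ?thesis .
qed

text \<open>Every fibre consists of a vertex and its blue partner, which are distinct.\<close>

lemma sum_edge_of: "(\<Sum>x\<in>verts. f (edge_of x)) = 2 * (\<Sum>e\<in>skeleton G S. f e :: real)"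
proof -
  have "(\<Sum>x\<in>verts. f (edge_of x))
      = (\<Sum>e\<in>skeleton G S. \<Sum>x | x \<in> verts \<and> edge_of x = e. f (edge_of x))"
    unfolding skeleton_eq by (rule sum.image_gen) (rule finite_verts)
  also have "\<dots> = (\<Sum>e\<in>skeleton G S. 2 * f e)"
  proof (rule sum.cong)
    fix e assume "e \<in> skeleton G S"
    then obtain x where x: "x \<in> verts" "e = edge_of x" by (auto simp: skeleton_eq)
    then have "x \<noteq> blue_map G x" using fst_blue_map_neq by metis
    then have "card {y \<in> verts. edge_of y = e} = 2" using x by (simp add: edge_of_fibre)
    then show "(\<Sum>x | x \<in> verts \<and> edge_of x = e. f (edge_of x)) = 2 * f e" by simp
  qed simp
  finally show ?thesis by (simp add: sum_distrib_left)
qed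

section \<open>Regularity, symmetry and row sums of the operators\<close>

lemma red_regular:
  "\<exists>k>0. \<forall>x\<in>verts. card {y \<in> verts. red_adj S x y} = k"
proof -
  obtain k where k: "k > 0" "\<And>\<tau>. \<tau> \<in> pair_types S \<Longrightarrow> card {\<tau>'. link_adj S \<tau> \<tau>'} = k"
    using link_regular by blast
  have "card {y \<in> verts. red_adj S x y} = k" if "x \<in> verts" for x
    using that k(2) by (simp add: red_nbrs_eq card_image inj_on_def) (auto simp: zigzag_verts_def)
  with k(1) show ?thesis by blast
qed

lemma red_degree_pos: "x \<in> verts \<Longrightarrow> card {y \<in> verts. red_adj S x y} > 0"
  using red_regular by fastforce

lemma walk_degree:
  assumes "x \<in> verts"
  shows "card {e \<in> skeleton G S. walk_adj G S (edge_of x) e} = 2 * card {y \<in> verts. red_adj S x y}"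
proof -
  obtain k where "k > 0" and k: "\<And>x. x \<in> verts \<Longrightarrow> card {y \<in> verts. red_adj S x y} = k"
    using red_regular by blast
  show ?thesis
    using sum_walk_nbrs[OF assms, of "\<lambda>_. 1::nat"] k[OF assms] k[OF blue_map_in_verts[OF assms]]
    by simp
qed

lemma symmetric_P_red: "symmetric_on verts (P_red G S)"
proof -
  obtain k where "k > 0" and k: "\<And>x. x \<in> verts \<Longrightarrow> card {y \<in> verts. red_adj S x y} = k"
    using red_regular by blast
  from k show ?thesis unfolding P_red_def
    by (rule symmetric_on_norm_adj[rotated]) (auto simp: red_adj_def link_adj_sym)
qed

lemma P_red_row_sum: "x \<in> verts \<Longrightarrow> (\<Sum>y\<in>verts. P_red G S x y) = 1"
  unfolding P_red_def by (rule norm_adj_row_sum[OF finite_verts red_degree_pos])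

lemma symmetric_P_blue: "symmetric_on verts (P_blue G)"
proof -
  have "y = blue_map G x \<longleftrightarrow> x = blue_map G y" if "x \<in> verts" "y \<in> verts" for x y
  proof
    show "x = blue_map G y" if "y = blue_map G x"
      unfolding that by (rule blue_map_involution[OF \<open>x \<in> verts\<close>, symmetric])
    show "y = blue_map G x" if "x = blue_map G y"
      unfolding that by (rule blue_map_involution[OF \<open>y \<in> verts\<close>, symmetric])
  qed
  then show ?thesis unfolding symmetric_on_def P_blue_def
    by (intro ballI arg_cong[where f = of_bool])
qed

lemma mat_vec_P_blue:
  assumes "x \<in> verts"
  shows "mat_vec verts (P_blue G) F x = F (blue_map G x)"
proof -
  have "mat_vec verts (P_blue G) F x = (\<Sum>y\<in>verts. if y = blue_map G x then F y else 0)"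
    by (auto simp: mat_vec_def P_blue_def intro!: sum.cong)
  with blue_map_in_verts[OF assms] show ?thesis by (simp add: finite_verts)
qed

lemma mat_vec_zigzag:
  "mat_vec verts (zigzag_matrix G S) F x
    = mat_vec verts (P_red G S) (\<lambda>y. mat_vec verts (P_red G S) F (blue_map G y)) x"
  unfolding zigzag_matrix_def mat_vec_mat_prod
  by (rule mat_vec_cong) (simp add: mat_vec_mat_prod mat_vec_P_blue)

lemma symmetric_zigzag: "symmetric_on verts (zigzag_matrix G S)"
  unfolding zigzag_matrix_def by (intro symmetric_on_conj symmetric_P_red symmetric_P_blue)

lemma zigzag_row_sum:
  assumes "x \<in> verts"
  shows "(\<Sum>y\<in>verts. zigzag_matrix G S x y) = 1"
proof -
  have one: "mat_vec verts (P_red G S) (\<lambda>_. 1) y = 1" if "y \<in> verts" for y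
    using P_red_row_sum[OF that] by (simp add: mat_vec_def)
  have "(\<Sum>y\<in>verts. zigzag_matrix G S x y) = mat_vec verts (zigzag_matrix G S) (\<lambda>_. 1) x"
    by (simp add: mat_vec_def)
  also have "\<dots> = mat_vec verts (P_red G S) (\<lambda>_. 1) x"
    unfolding mat_vec_zigzag by (rule mat_vec_cong) (simp add: one blue_map_in_verts)
  finally show ?thesis using one[OF assms] by simp
qed

abbreviation "walk_matrix \<equiv> norm_adj (skeleton G S) (walk_adj G S)"

lemma symmetric_walk: "symmetric_on (skeleton G S) walk_matrix"
proof -
  obtain k where "k > 0" and k: "\<And>x. x \<in> verts \<Longrightarrow> card {y \<in> verts. red_adj S x y} = k"
    using red_regular by blast
  have "card {e' \<in> skeleton G S. walk_adj G S e e'} = 2 * k" if "e \<in> skeleton G S" for e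
  proof -
    obtain x where "x \<in> verts" "e = edge_of x" using \<open>e \<in> skeleton G S\<close> skeleton_eq by blast
    then show ?thesis by (simp add: walk_degree k)
  qed
  moreover have "walk_adj G S e e' \<longleftrightarrow> walk_adj G S e' e" for e e'
    by (auto simp: walk_adj_def Un_commute)
  ultimately show ?thesis by (intro symmetric_on_norm_adj)
qed

lemma walk_row_sum:
  assumes "e \<in> skeleton G S"
  shows "(\<Sum>e'\<in>skeleton G S. walk_matrix e e') = 1"
proof (rule norm_adj_row_sum[OF finite_skeleton])
  show "card {e' \<in> skeleton G S. walk_adj G S e e'} > 0"
  proof -
    obtain x where "x \<in> verts" "e = edge_of x" using assms skeleton_eq by blast
    then show ?thesis by (simp add: walk_degree red_degree_pos del: card_gt_0_iff)
  qed
qed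

text \<open>The walk has twice the red degree, so its average is the mean of the red averages at the
  two lifts; this is the operator \<open>(I + P\<^sub>B) / 2 \<cdot> P\<^sub>R\<close> on
  pulled-back vectors.\<close>

lemma mat_vec_walk_lift:
  assumes "x \<in> verts"
  shows "mat_vec (skeleton G S) walk_matrix f (edge_of x)
    = (mat_vec verts (P_red G S) (\<lambda>y. f (edge_of y)) x
        + mat_vec verts (P_red G S) (\<lambda>y. f (edge_of y)) (blue_map G x)) / 2"
proof -
  obtain k where "k > 0" and k: "\<And>x. x \<in> verts \<Longrightarrow> card {y \<in> verts. red_adj S x y} = k"
    using red_regular by blast
  show ?thesis
    unfolding P_red_def mat_vec_norm_adj[OF finite_skeleton] mat_vec_norm_adj[OF finite_verts]
      walk_degree[OF assms] sum_walk_nbrs[OF assms] k[OF assms] k[OF blue_map_in_verts[OF assms]]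
    using \<open>k > 0\<close> by (simp add: field_simps)
qed

section \<open>The eigenvalue estimate\<close>

lemma sum_blue_map: "(\<Sum>x\<in>verts. F (blue_map G x)) = (\<Sum>x\<in>verts. F x)"
  by (rule sum.reindex_bij_witness[of _ "blue_map G" "blue_map G"])
    (simp_all add: blue_map_in_verts blue_map_involution)

lemma walk_eigenvalue_bound:
  assumes f: "f \<in> eigenspace (skeleton G S) walk_matrix \<mu>" and "f \<noteq> 0"
    and sum0: "(\<Sum>e\<in>skeleton G S. f e) = 0"
  shows "\<mu>\<^sup>2 \<le> 1 / 2 + 1 / 2 * lambda_zigzag G S"
proof -
  define F where "F = (\<lambda>x. f (edge_of x))"
  define H where "H = mat_vec verts (P_red G S) F"
  let ?N = "\<Sum>x\<in>verts. (F x)\<^sup>2"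
  have "(\<Sum>x\<in>verts. F x) = 0"
    using sum_edge_of[of f] sum0 by (simp add: F_def)
  then have zz: "(\<Sum>x\<in>verts. F x * mat_vec verts (zigzag_matrix G S) F x) \<le> lambda_zigzag G S * ?N"
    unfolding lambda_zigzag_def
    by (intro rayleigh_le_spectral_lambda finite_verts symmetric_zigzag zigzag_row_sum)
  have H: "\<mu> * F x = (H x + H (blue_map G x)) / 2" if "x \<in> verts" for x
    using f mat_vec_walk_lift[OF that, of f] edge_of_in_skeleton[OF that]
    by (simp add: mem_eigenspace_iff F_def H_def)
  have "\<mu>\<^sup>2 * ?N = (\<Sum>x\<in>verts. ((H x + H (blue_map G x)) / 2)\<^sup>2)"
    by (simp add: sum_distrib_left H flip: power_mult_distrib)
  also have "\<dots> = (\<Sum>x\<in>verts. (H x)\<^sup>2 / 4 + (H (blue_map G x))\<^sup>2 / 4 + H x * H (blue_map G x) / 2)"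
    by (intro sum.cong) (simp_all add: power2_eq_square field_simps)
  \<comment> \<open>Reindexing along the blue matching identifies the two sums of squares.\<close>
  also have "\<dots> = (\<Sum>x\<in>verts. (H x)\<^sup>2) / 2 + (\<Sum>x\<in>verts. H x * H (blue_map G x)) / 2"
    using sum_blue_map[of "\<lambda>x. (H x)\<^sup>2"] by (simp add: sum.distrib flip: sum_divide_distrib)
  \<comment> \<open>Symmetry of the red operator moves it from one factor to the other, completing
    the zig-zag product.\<close>
  also have "(\<Sum>x\<in>verts. H x * H (blue_map G x))
      = (\<Sum>x\<in>verts. F x * mat_vec verts (zigzag_matrix G S) F x)"
    unfolding mat_vec_zigzag mat_vec_symmetric[OF symmetric_P_red] H_def ..
  also have "(\<Sum>x\<in>verts. (H x)\<^sup>2) / 2 + \<dots> / 2 \<le> ?N / 2 + lambda_zigzag G S * ?N / 2"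
  proof -
    have "0 \<le> P_red G S x y" for x y by (simp add: P_red_def norm_adj_def)
    then have "(\<Sum>x\<in>verts. (H x)\<^sup>2) \<le> ?N"
      unfolding H_def by (intro mat_vec_contraction symmetric_P_red P_red_row_sum)
    with zz show ?thesis by simp
  qed
  finally have "\<mu>\<^sup>2 * ?N \<le> (1 / 2 + 1 / 2 * lambda_zigzag G S) * ?N"
    by (simp add: algebra_simps)
  \<comment> \<open>Every edge of the skeleton has a lift, so \<open>F\<close> inherits a nonzero
    value from \<open>f\<close>.\<close>
  moreover have "?N > 0"
  proof -
    obtain e where "f e \<noteq> 0" using \<open>f \<noteq> 0\<close> by (auto simp: fun_eq_iff)
    then have "e \<in> skeleton G S" using f by (auto simp: mem_eigenspace_iff)
    with \<open>f e \<noteq> 0\<close> obtain x where "x \<in> verts" "F x \<noteq> 0"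
      unfolding skeleton_eq F_def by blast
    then show ?thesis by (intro sum_pos2[OF finite_verts]) auto
  qed
  ultimately show ?thesis by simp
qed

lemma lambda_walk_le: "lambda_walk G S \<le> sqrt (1 / 2 + 1 / 2 * lambda_zigzag G S)"
  unfolding lambda_walk_def
proof (rule spectral_lambda_leI[OF finite_skeleton symmetric_walk walk_row_sum])
  \<comment> \<open>Required because \<open>spectral_lambda\<close> inserts \<open>0\<close> into
    its maximum.\<close>
  show "0 \<le> sqrt (1 / 2 + 1 / 2 * lambda_zigzag G S)"
    using spectral_lambda_nonneg[OF finite_verts symmetric_zigzag] by (simp add: lambda_zigzag_def)
  show "\<bar>\<mu>\<bar> \<le> sqrt (1 / 2 + 1 / 2 * lambda_zigzag G S)"
    if "f \<in> eigenspace (skeleton G S) walk_matrix \<mu>" "f \<noteq> 0" "(\<Sum>e\<in>skeleton G S. f e) = 0" for \<mu> f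
    using walk_eigenvalue_bound[OF that] by (simp add: real_le_rsqrt)
qed

end

theorem mainTheorem1:
  fixes G :: "('a, 'b) monoid_scheme" and S :: "'a set set"
  assumes "group G" and "finite (carrier G)"
    and "\<And>\<sigma>. \<sigma> \<in> S \<Longrightarrow> \<sigma> \<subseteq> carrier G \<and> card \<sigma> = 3"
    and "commutative_triplet_structure G S"
  shows "lambda_walk G S \<le> sqrt (1 / 2 + 1 / 2 * lambda_zigzag G S)"
proof -
  interpret commutative_triplet G S
    using assms by (simp add: commutative_triplet_def commutative_triplet_axioms_def)
  show ?thesis by (rule lambda_walk_le)
qed

end
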